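(* Let $D$ satisfy (H1), (H2), (H3) as listed in the context. For $f\in L^2(\Omega)$ let $m(f)=\frac{1}{A(\Omega)}\int_\Omega f(\mathbf{x})\,d\Omega$, where $A(\Omega)$ is the area of $\Omega$, and for $\mathbf{u}=(u,v)^T$ let $\mathbf{M}(\mathbf{u})=(m(u),m(v))^T$. Then, for every initial datum $\mathbf{u}_0\in X_1$, $$\mathbf{M}(T_t(\mathbf{u}_0))=\mathbf{M}(\mathbf{u}_0),\qquad t\ge0.$$
   Context: $\Omega\subset\mathbb{R}^2$ is a bounded (typically rectangular) domain with boundary $\partial\Omega$ and outward normal $n$; $T>0$, $Q_T=\Omega\times(0,T]$, $\overline{Q_T}=\overline\Omega\times[0,T]$. $X_k=H^k(\Omega)\times H^k(\Omega)$, with $H^0(\Omega)=L^2(\Omega)$. $J\mathbf{u}$ is the Jacobian matrix of $\mathbf{u}=(u,v)^T$ with respect to the space variables (rows $\nabla u$, $\nabla v$). The cross-diffusion matrix $D=(D_{ij})_{i,j=1,2}$ assigns to $\mathbf{u}:\overline{Q_T}\to\mathbb{R}^2$ the matrix-valued function $D(\mathbf{u})(\mathbf{x},t)=D(\mathbf{u}(\mathbf{x},t))\in M_{2\times2}(\mathbb{R})$. The hypotheses on $D$ are: (H1) there is $\alpha>0$ such that for each $\mathbf{u}:\overline{Q_T}\to\mathbb{R}^2$, $\xi^TD(\mathbf{u}(\mathbf{x},t))\xi\ge\alpha|\xi|^2$ for all $\xi\in\mathbb{R}^2$, $(\mathbf{x},t)\in\overline{Q_T}$; (H2) there is $L>0$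 such that for all $\mathbf{u},\mathbf{v}:\overline{Q_T}\to\mathbb{R}^2$, $(\mathbf{x},t)\in\overline{Q_T}$, $i,j=1,2$, $|D_{ij}(\mathbf{v}(\mathbf{x},t))-D_{ij}(\mathbf{u}(\mathbf{x},t))|\le L|\mathbf{v}(\mathbf{x},t)-\mathbf{u}(\mathbf{x},t)|$; (H3) there is $M>0$ such that for each $\mathbf{u}:\overline{Q_T}\to\mathbb{R}^2$, $|D_{ij}(\mathbf{u}(\mathbf{x},t))|\le M$ for all $(\mathbf{x},t)\in\overline{Q_T}$, $i,j=1,2$. Problem (P), for $\mathbf{u}=(u,v)^T$: $$\partial_t u=\mathrm{div}(D_{11}(\mathbf{u})\nabla u+D_{12}(\mathbf{u})\nabla v),\quad \partial_t v=\mathrm{div}(D_{21}(\mathbf{u})\nabla u+D_{22}(\mathbf{u})\nabla v)\quad\text{in }Q_T,$$ with $u(\mathbf{x},0)=u_0(\mathbf{x})$, $v(\mathbf{x},0)=v_0(\mathbf{x})$ for $\mathbf{x}\in\Omega$, and on $\partial\Omega\times[0,T]$: $\langle D_{11}(\mathbf{u})\nabla u+D_{12}(\mathbf{u})\nabla v,n\rangle=0$, $\langle D_{21}(\mathbf{u})\nabla u+D_{22}(\mathbf{u})\nabla v,n\rangle=0$. A weak solution of (P) is $\mathbf{u}=(u,v)^T\in C(0,T,X_0)\cap L^2(0,T,X_1)$, with $\mathbf{u}(0)=\mathbf{u}_0$, such that for any $t\in(0,T]$ $$\int_\Omega\left((\partial_tu)w_1+(\partial_tv)w_2\right)d\Omega+\int_\Omega\mathrm{tr}\left((J\mathbf{w})^TD(\mathbf{u})(J\mathbf{u})\right)d\Omega=0\quad\text{for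 all }\mathbf{w}=(w_1,w_2)^T\in X_1,$$ where $\mathrm{tr}$ is the trace and the integral of a product of an element of $(H^1(\Omega))'$ and one of $H^1(\Omega)$ is understood as the duality pairing. Under (H1)-(H3), for $\mathbf{u}_0\in X_1$ the weak solution exists and is unique for every $T>0$. Scale-space operator: for $t\ge0$, $T_t(\mathbf{u}_0):=\mathbf{u}(t)=\mathbf{u}(\cdot,t)$, where $\mathbf{u}$ is the unique weak solution of (P) with initial data $\mathbf{u}_0$ ($T$ being arbitrary). *)

theory Defs
  imports "HOL-Analysis.Analysis"
begin

(* Elements of Lebesgue, Sobolev and dual spaces are represented by functions, not by equivalence
   classes; equality in L^2(Omega) is equality almost everywhere in Omega. *)

definition planar_domain :: "(real^2) set \<Rightarrow> bool" where
  "planar_domain \<Omega> \<longleftrightarrow> open \<Omega> \<and> connected \<Omega> \<and> bounded \<Omega> \<and> \<Omega> \<noteq> {}"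

primrec C_k :: "nat \<Rightarrow> ('a::euclidean_space \<Rightarrow> real) \<Rightarrow> bool" where
  "C_k 0 f \<longleftrightarrow> continuous_on UNIV f"
| "C_k (Suc k) f \<longleftrightarrow> (\<forall>x. f differentiable (at x)) \<and>
     (\<forall>b\<in>Basis. C_k k (\<lambda>x. frechet_derivative f (at x) b))"

definition test_function :: "'a::euclidean_space set \<Rightarrow> ('a \<Rightarrow> real) \<Rightarrow> bool" where
  "test_function U \<phi> \<longleftrightarrow> (\<forall>k. C_k k \<phi>) \<and>
     compact (closure {x. \<phi> x \<noteq> 0}) \<and> closure {x. \<phi> x \<noteq> 0} \<subseteq> U"

definition L2 :: "(real^2) set \<Rightarrow> (real^2 \<Rightarrow> real) set" where
  "L2 \<Omega> = {f. f \<in> borel_measurable (lebesgue_on \<Omega>) \<and> integrable (lebesgue_on \<Omega>) (\<lambda>x. (f x)\<^sup>2)}"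

definition L2_norm :: "(real^2) set \<Rightarrow> (real^2 \<Rightarrow> real) \<Rightarrow> real" where
  "L2_norm \<Omega> f = sqrt (LINT x|lebesgue_on \<Omega>. (f x)\<^sup>2)"

(* f and all its weak first partial derivatives g_1, g_2 lie in L^2(Omega). The gradient g is kept
   as a second argument of a relation; it is determined by f only almost everywhere. *)
definition weak_gradient :: "(real^2) set \<Rightarrow> (real^2 \<Rightarrow> real) \<Rightarrow> (real^2 \<Rightarrow> real^2) \<Rightarrow> bool" where
  "weak_gradient \<Omega> f g \<longleftrightarrow> f \<in> L2 \<Omega> \<and> (\<forall>j. (\<lambda>x. g x $ j) \<in> L2 \<Omega>) \<and>
     (\<forall>\<phi>. test_function \<Omega> \<phi> \<longrightarrow> (\<forall>j.
        (LINT x|lebesgue_on \<Omega>. f x * frechet_derivative \<phi> (at x) (axis j 1)) =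
        - (LINT x|lebesgue_on \<Omega>. g x $ j * \<phi> x)))"

definition H1 :: "(real^2) set \<Rightarrow> (real^2 \<Rightarrow> real) set" where
  "H1 \<Omega> = {f. \<exists>g. weak_gradient \<Omega> f g}"

(* All weak gradients of f agree almost everywhere, so the value r is unique for f in H1. *)
definition H1_norm :: "(real^2) set \<Rightarrow> (real^2 \<Rightarrow> real) \<Rightarrow> real" where
  "H1_norm \<Omega> f = (THE r. \<exists>g. weak_gradient \<Omega> f g \<and>
     r = sqrt ((LINT x|lebesgue_on \<Omega>. (f x)\<^sup>2) + (LINT x|lebesgue_on \<Omega>. (norm (g x))\<^sup>2)))"

definition X0 :: "(real^2) set \<Rightarrow> (real^2 \<Rightarrow> real^2) set" where
  "X0 \<Omega> = {w. \<forall>i. (\<lambda>x. w x $ i) \<in> L2 \<Omega>}"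

definition X0_norm :: "(real^2) set \<Rightarrow> (real^2 \<Rightarrow> real^2) \<Rightarrow> real" where
  "X0_norm \<Omega> w = sqrt (\<Sum>i\<in>UNIV. (L2_norm \<Omega> (\<lambda>x. w x $ i))\<^sup>2)"

definition X1 :: "(real^2) set \<Rightarrow> (real^2 \<Rightarrow> real^2) set" where
  "X1 \<Omega> = {w. \<forall>i. (\<lambda>x. w x $ i) \<in> H1 \<Omega>}"

definition X1_norm :: "(real^2) set \<Rightarrow> (real^2 \<Rightarrow> real^2) \<Rightarrow> real" where
  "X1_norm \<Omega> w = sqrt (\<Sum>i\<in>UNIV. (H1_norm \<Omega> (\<lambda>x. w x $ i))\<^sup>2)"

definition weak_jacobian :: "(real^2) set \<Rightarrow> (real^2 \<Rightarrow> real^2) \<Rightarrow> (real^2 \<Rightarrow> real^2^2) \<Rightarrow> bool" where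
  "weak_jacobian \<Omega> w J \<longleftrightarrow> (\<forall>i. weak_gradient \<Omega> (\<lambda>x. w x $ i) (\<lambda>x. J x $ i))"

(* Functionals act on representatives; the bound by the H1 norm makes them respect almost
   everywhere equality. Values outside H1 are irrelevant. *)
definition H1_dual :: "(real^2) set \<Rightarrow> ((real^2 \<Rightarrow> real) \<Rightarrow> real) set" where
  "H1_dual \<Omega> = {l.
     (\<forall>f\<in>H1 \<Omega>. \<forall>g\<in>H1 \<Omega>. \<forall>a b. l (\<lambda>x. a * f x + b * g x) = a * l f + b * l g) \<and>
     (\<exists>C. \<forall>f\<in>H1 \<Omega>. \<bar>l f\<bar> \<le> C * H1_norm \<Omega> f)}"

definition H1_dual_norm :: "(real^2) set \<Rightarrow> ((real^2 \<Rightarrow> real) \<Rightarrow> real) \<Rightarrow> real" where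
  "H1_dual_norm \<Omega> l = (SUP f\<in>{f \<in> H1 \<Omega>. H1_norm \<Omega> f \<le> 1}. \<bar>l f\<bar>)"

definition C_X0 :: "(real^2) set \<Rightarrow> real \<Rightarrow> (real \<Rightarrow> real^2 \<Rightarrow> real^2) set" where
  "C_X0 \<Omega> T = {u. (\<forall>t\<in>{0..T}. u t \<in> X0 \<Omega>) \<and>
     (\<forall>s\<in>{0..T}. ((\<lambda>t. X0_norm \<Omega> (u t - u s)) \<longlongrightarrow> 0) (at s within {0..T}))}"

(* The Bochner space L^2(0,T;V), for a space V of functions with norm N: strong measurability is
   almost everywhere approximation by V-valued simple functions. *)
definition L2_time :: "real \<Rightarrow> ('a::minus) set \<Rightarrow> ('a \<Rightarrow> real) \<Rightarrow> (real \<Rightarrow> 'a) set" where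
  "L2_time T V N = {u.
     (AE t in lebesgue_on {0..T}. u t \<in> V) \<and>
     (\<exists>s :: nat \<Rightarrow> real \<Rightarrow> 'a.
        (\<forall>n. simple_function (lebesgue_on {0..T}) (s n) \<and> (\<forall>t\<in>{0..T}. s n t \<in> V)) \<and>
        (AE t in lebesgue_on {0..T}. (\<lambda>n. N (s n t - u t)) \<longlonglongrightarrow> 0)) \<and>
     integrable (lebesgue_on {0..T}) (\<lambda>t. (N (u t))\<^sup>2)}"

(* p, an element of L^2(0,T;(H^1)'), is the distributional time derivative of the scalar function u
   in the sense of the triple H^1 < L^2 < (H^1)'. The number p t w is the duality pairing that is
   informally written as the integral over Omega of the product of the time derivative and w. *)
definition time_derivative ::
    "(real^2) set \<Rightarrow> real \<Rightarrow> (real \<Rightarrow> real^2 \<Rightarrow> real) \<Rightarrow> (real \<Rightarrow> (real^2 \<Rightarrow> real) \<Rightarrow> real) \<Rightarrow> bool" where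
  "time_derivative \<Omega> T u p \<longleftrightarrow> p \<in> L2_time T (H1_dual \<Omega>) (H1_dual_norm \<Omega>) \<and>
     (\<forall>w\<in>H1 \<Omega>. \<forall>\<phi>. test_function {0<..<T} \<phi> \<longrightarrow>
        (LINT t|lebesgue_on {0..T}. p t w * \<phi> t) =
        - (LINT t|lebesgue_on {0..T}. (LINT x|lebesgue_on \<Omega>. u t x * w x) * deriv \<phi> t))"

(* D(u)(x,t) = D(u(x,t)), and u ranges over all functions into the plane, so the hypotheses on D
   are conditions on the values D z at arbitrary points z of the plane. *)

definition D_elliptic :: "(real^2 \<Rightarrow> real^2^2) \<Rightarrow> bool" where
  "D_elliptic D \<longleftrightarrow> (\<exists>\<alpha>>0. \<forall>z \<xi>. \<xi> \<bullet> (D z *v \<xi>) \<ge> \<alpha> * (norm \<xi>)\<^sup>2)"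

definition D_lipschitz :: "(real^2 \<Rightarrow> real^2^2) \<Rightarrow> bool" where
  "D_lipschitz D \<longleftrightarrow> (\<exists>L>0. \<forall>y z i j. \<bar>D z $ i $ j - D y $ i $ j\<bar> \<le> L * norm (z - y))"

definition D_bounded :: "(real^2 \<Rightarrow> real^2^2) \<Rightarrow> bool" where
  "D_bounded D \<longleftrightarrow> (\<exists>M>0. \<forall>z i j. \<bar>D z $ i $ j\<bar> \<le> M)"

(* The homogeneous Neumann condition is encoded by testing with all of X_1. An element of
   L^2(0,T;X_1) has a Jacobian only for almost every t, whence "AE t". *)
definition weak_solution ::
    "(real^2) set \<Rightarrow> (real^2 \<Rightarrow> real^2^2) \<Rightarrow> real \<Rightarrow> (real^2 \<Rightarrow> real^2) \<Rightarrow> (real \<Rightarrow> real^2 \<Rightarrow> real^2) \<Rightarrow> bool"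
  where
  "weak_solution \<Omega> D T u0 u \<longleftrightarrow>
     u \<in> C_X0 \<Omega> T \<and> u \<in> L2_time T (X1 \<Omega>) (X1_norm \<Omega>) \<and>
     (AE x in lebesgue_on \<Omega>. u 0 x = u0 x) \<and>
     (\<exists>p q. time_derivative \<Omega> T (\<lambda>t x. u t x $ 1) p \<and> time_derivative \<Omega> T (\<lambda>t x. u t x $ 2) q \<and>
        (AE t in lebesgue_on {0..T}. \<forall>Ju w Jw. weak_jacobian \<Omega> (u t) Ju \<longrightarrow> weak_jacobian \<Omega> w Jw \<longrightarrow>
           p t (\<lambda>x. w x $ 1) + q t (\<lambda>x. w x $ 2) +
           (LINT x|lebesgue_on \<Omega>. trace (transpose (Jw x) ** D (u t x) ** Ju x)) = 0))"

definition well_posed :: "(real^2) set \<Rightarrow> (real^2 \<Rightarrow> real^2^2) \<Rightarrow> (real^2 \<Rightarrow> real^2) \<Rightarrow> bool" where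
  "well_posed \<Omega> D u0 \<longleftrightarrow> (\<forall>T>0.
     (\<exists>u. weak_solution \<Omega> D T u0 u) \<and>
     (\<forall>u v. weak_solution \<Omega> D T u0 u \<longrightarrow> weak_solution \<Omega> D T u0 v \<longrightarrow>
        (\<forall>t\<in>{0..T}. AE x in lebesgue_on \<Omega>. u t x = v t x)))"

(* When the problem is well posed for u0, the chosen function is a representative of the unique
   element u(t) of X_0, independently of T. *)
definition scale_space :: "(real^2) set \<Rightarrow> (real^2 \<Rightarrow> real^2^2) \<Rightarrow> real \<Rightarrow> (real^2 \<Rightarrow> real^2) \<Rightarrow> (real^2 \<Rightarrow> real^2)"
  where
  "scale_space \<Omega> D t u0 = (SOME w. \<exists>T u. 0 < T \<and> t \<in> {0..T} \<and> weak_solution \<Omega> D T u0 u \<and> w = u t)"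

definition mean :: "(real^2) set \<Rightarrow> (real^2 \<Rightarrow> real) \<Rightarrow> real" where
  "mean \<Omega> f = 1 / measure lebesgue \<Omega> * (LINT x|lebesgue_on \<Omega>. f x)"

definition mean_vector :: "(real^2) set \<Rightarrow> (real^2 \<Rightarrow> real^2) \<Rightarrow> real^2" where
  "mean_vector \<Omega> w = (\<chi> i. mean \<Omega> (\<lambda>x. w x $ i))"

end

theory Submission
  imports Defs "HOL-Computational_Algebra.Polynomial"
begin

text \<open>Constants lie in \<open>H1\<close> with gradient zero, because a partial derivative of a test function
  integrates to zero. Testing the weak formulation with a constant field therefore leaves
  \<open>\<langle>\<partial>\<^sub>t u\<^sub>i, 1\<rangle> = 0\<close> for almost every time, so the distributional derivative of
  \<open>t \<mapsto> \<integral> u\<^sub>i(t)\<close> vanishes on \<open>(0, T)\<close>. This function is continuous on \<open>[0, T]\<close> by Cauchy--Schwarz,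
  hence constant by the du Bois-Reymond lemma. The latter is proved by contradiction: if
  \<open>m a < c < m b\<close>, a test function whose derivative is a bump at \<open>a\<close> minus the same bump at \<open>b\<close>
  makes \<open>(c - m) \<phi>'\<close> nonnegative, nonzero and of integral zero.\<close>

section \<open>Smooth functions on the line and the du Bois-Reymond lemma\<close>

text \<open>\<open>C_k (Suc k)\<close> asks only for differentiability and regular partial
  derivatives, so continuity at the lowest level has to come from differentiability.\<close>

lemma C_k_SucD: "C_k (Suc k) f \<Longrightarrow> C_k k f"
proof (induction k arbitrary: f)
  case 0
  then show ?case
    by (auto intro!: continuous_at_imp_continuous_on differentiable_imp_continuous_within)
next
  case (Suc k)
  then show ?case by (metis C_k.simps(2))
qed

text \<open>The standard basis of the line is \<open>{1}\<close>, so ordinary derivatives can stand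
  in for \<open>frechet_derivative\<close> in the inductions on \<open>k\<close>.\<close>

lemma C_k_Suc_real:
  assumes "\<And>x. (f has_real_derivative f' x) (at x)"
  shows "C_k (Suc k) f \<longleftrightarrow> C_k k f'"
proof -
  have "frechet_derivative f (at x) = (*) (f' x)" for x
    using assms frechet_derivative_at[of f "(*) (f' x)" x] by (auto simp: has_field_derivative_def)
  moreover have "f differentiable at x" for x
    using assms real_differentiable_def by blast
  ultimately show ?thesis by simp
qed

lemma C_k_Suc_realE:
  assumes "C_k (Suc k) f"
  obtains f' where "\<And>x. (f has_real_derivative f' x) (at x)" "C_k k f'"
  using assms C_k_Suc_real[of f "deriv f" k] DERIV_deriv_iff_real_differentiable[of f] by auto

lemma C_k_add_real:
  fixes f g :: "real \<Rightarrow> real"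
  assumes "C_k k f" "C_k k g"
  shows "C_k k (\<lambda>x. f x + g x)"
  using assms
proof (induction k arbitrary: f g)
  case 0
  then show ?case by (auto intro: continuous_intros)
next
  case (Suc k)
  obtain f' where f: "\<And>x. (f has_real_derivative f' x) (at x)" "C_k k f'"
    using C_k_Suc_realE[OF Suc.prems(1)] by blast
  obtain g' where g: "\<And>x. (g has_real_derivative g' x) (at x)" "C_k k g'"
    using C_k_Suc_realE[OF Suc.prems(2)] by blast
  have "((\<lambda>x. f x + g x) has_real_derivative f' x + g' x) (at x)" for x
    by (intro DERIV_add f g)
  from C_k_Suc_real[OF this] show ?case using Suc.IH[OF f(2) g(2)] by blast
qed

lemma C_k_mult_real:
  fixes f g :: "real \<Rightarrow> real"
  assumes "C_k k f" "C_k k g"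
  shows "C_k k (\<lambda>x. f x * g x)"
  using assms
proof (induction k arbitrary: f g)
  case 0
  then show ?case by (auto intro: continuous_intros)
next
  case (Suc k)
  obtain f' where f: "\<And>x. (f has_real_derivative f' x) (at x)" "C_k k f'"
    using C_k_Suc_realE[OF Suc.prems(1)] by blast
  obtain g' where g: "\<And>x. (g has_real_derivative g' x) (at x)" "C_k k g'"
    using C_k_Suc_realE[OF Suc.prems(2)] by blast
  have "((\<lambda>x. f x * g x) has_real_derivative f' x * g x + g' x * f x) (at x)" for x
    by (intro DERIV_mult f g)
  \<comment> \<open>The undifferentiated factors are known at level \<open>Suc k\<close> and are
    lowered to \<open>k\<close> before the induction hypothesis applies.\<close>
  moreover have "C_k k (\<lambda>x. f' x * g x + g' x * f x)"
    by (intro C_k_add_real Suc.IH f(2) g(2) Suc.prems[THEN C_k_SucD])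
  ultimately show ?case by (subst C_k_Suc_real)
qed

text \<open>The factor \<open>a\<close> is there for the induction: each differentiation turns it
  into \<open>a * c\<close>. Translates, reflections and negatives of a bump are instances.\<close>

lemma C_k_affine_real:
  fixes f :: "real \<Rightarrow> real"
  assumes "C_k k f"
  shows "C_k k (\<lambda>x. a * f (c * x + d))"
  using assms
proof (induction k arbitrary: f a)
  case 0
  then show ?case
    by (auto intro!: continuous_intros continuous_on_compose2[of UNIV f])
next
  case (Suc k)
  obtain f' where f: "\<And>x. (f has_real_derivative f' x) (at x)" "C_k k f'"
    using C_k_Suc_realE[OF Suc.prems] by blast
  have "((\<lambda>x. a * f (c * x + d)) has_real_derivative (a * c) * f' (c * x + d)) (at x)" for x
    by (auto intro!: derivative_eq_intros DERIV_chain2[OF f(1)])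
  from C_k_Suc_real[OF this] show ?case using Suc.IH[OF f(2)] by blast
qed

text \<open>A family closed under differentiation, so smoothness is a single induction.\<close>

definition exp_flat :: "real poly \<Rightarrow> real \<Rightarrow> real" where
  "exp_flat p x = (if x > 0 then poly p (1 / x) * exp (- (1 / x)) else 0)"

text \<open>The exponential outgrows every monomial. With \<open>z = 1 / x\<close> this gives the
  decay of \<open>exp_flat\<close> at the origin from the right.\<close>

lemma poly_times_exp_minus_tendsto_0:
  "((\<lambda>z. poly p z * exp (- z)) \<longlongrightarrow> (0::real)) at_top"
proof -
  have "((\<lambda>z. \<Sum>i\<le>degree p. coeff p i * (z ^ i / exp z)) \<longlongrightarrow> (\<Sum>i\<le>degree p. coeff p i * 0)) at_top"
    by (intro tendsto_intros tendsto_power_div_exp_0)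
  then show ?thesis
    by (simp add: poly_altdef exp_minus sum_distrib_right divide_inverse mult.assoc)
qed

text \<open>Put \<open>z = 1 / x\<close>, so that \<open>dz/dx = - z^2\<close>, while
  \<open>p(z) exp (- z)\<close> has \<open>z\<close>-derivative
  \<open>(p' - p)(z) exp (- z)\<close>. The polynomial \<open>[:0, 0, 1:]\<close> is the factor
  \<open>z^2\<close>.\<close>

lemma exp_flat_has_derivative:
  "(exp_flat p has_real_derivative exp_flat ([:0, 0, 1:] * (p - pderiv p)) x) (at x)"
proof (cases x "0::real" rule: linorder_cases)
  case less
  have "((\<lambda>_. 0) has_real_derivative 0) (at x)" by simp
  then have "(exp_flat p has_real_derivative 0) (at x)"
    by (rule has_field_derivative_transform_within_open[of _ _ _ "{..<0}"])
      (use less in \<open>auto simp: exp_flat_def\<close>)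
  then show ?thesis using less by (simp add: exp_flat_def)
next
  case equal
  \<comment> \<open>The difference quotient at 0 is \<open>exp_flat p y / y\<close>; dividing by
    \<open>y\<close> is multiplying by \<open>z = 1 / y\<close>, which is the polynomial
    \<open>[:0, 1:]\<close>.\<close>
  have "((\<lambda>z. poly ([:0, 1:] * p) z * exp (- z)) \<longlongrightarrow> 0) at_top"
    by (rule poly_times_exp_minus_tendsto_0)
  then have "((\<lambda>y. poly ([:0, 1:] * p) (inverse y) * exp (- inverse y)) \<longlongrightarrow> 0) (at_right (0::real))"
    by (simp add: filterlim_at_right_to_top)
  then have "((\<lambda>y. exp_flat p y / y) \<longlongrightarrow> 0) (at_right 0)"
    by (rule Lim_transform_eventually)
      (auto simp: exp_flat_def eventually_at_filter field_simps)
  moreover have "((\<lambda>y. exp_flat p y / y) \<longlongrightarrow> 0) (at_left 0)"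
    by (rule tendsto_eventually) (auto simp: exp_flat_def eventually_at_filter)
  ultimately show ?thesis
    using equal by (simp add: has_field_derivative_iff filterlim_split_at exp_flat_def)
next
  case greater
  have "((\<lambda>x. poly p (1 / x) * exp (- (1 / x))) has_real_derivative
      poly ([:0, 0, 1:] * (p - pderiv p)) (1 / x) * exp (- (1 / x))) (at x)"
    using greater by (auto intro!: derivative_eq_intros simp: field_simps power2_eq_square)
  then have "(exp_flat p has_real_derivative
      poly ([:0, 0, 1:] * (p - pderiv p)) (1 / x) * exp (- (1 / x))) (at x)"
    by (rule has_field_derivative_transform_within_open[of _ _ _ "{0<..}"])
      (use greater in \<open>auto simp: exp_flat_def\<close>)
  then show ?thesis using greater by (simp add: exp_flat_def)
qed

lemma C_k_exp_flat: "C_k k (exp_flat p)"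
proof (induction k arbitrary: p)
  case 0
  then show ?case
    using exp_flat_has_derivative by (auto intro!: DERIV_continuous_on)
next
  case (Suc k)
  then show ?case using C_k_Suc_real[OF exp_flat_has_derivative] by blast
qed

section \<open>Bumps, test functions with prescribed derivative, du Bois-Reymond\<close>

lemma smooth_bump_exists:
  fixes e :: real
  assumes "e > 0"
  obtains \<psi> :: "real \<Rightarrow> real" where "\<And>k. C_k k \<psi>" "\<And>x. \<psi> x \<ge> 0" "\<psi> 0 > 0" "\<And>x. \<bar>x\<bar> \<ge> e \<Longrightarrow> \<psi> x = 0"
proof
  \<comment> \<open>The first factor is positive exactly for \<open>x > - e\<close>, the second
    exactly for \<open>x < e\<close>. The redundant factors 1 fit the pattern of
    \<open>C_k_affine_real\<close>.\<close>
  let ?\<psi> = "\<lambda>x. (1 * exp_flat 1 (1 * x + e)) * (1 * exp_flat 1 (-1 * x + e))"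
  show "C_k k ?\<psi>" for k
    by (intro C_k_mult_real C_k_affine_real C_k_exp_flat)
qed (use assms in \<open>auto simp: exp_flat_def\<close>)

text \<open>An antiderivative \<open>F\<close> of one bump is constant on either side of the
  support, but with different constants. In the difference of two translates of \<open>F\<close>
  these constants cancel at both ends, which leaves a compact support.\<close>

lemma test_function_difference_of_bumps:
  fixes a b e S T :: real
  assumes e: "e > 0" and ab: "S < a - e" "a + e < T" "S < b - e" "b + e < T"
  shows "\<exists>\<phi> \<psi>. test_function {S<..<T} \<phi> \<and>
    (\<forall>t. (\<phi> has_real_derivative \<psi> (t - a) - \<psi> (t - b)) (at t)) \<and>
    continuous_on UNIV \<psi> \<and> (\<forall>x. \<psi> x \<ge> 0) \<and> \<psi> 0 > 0 \<and> (\<forall>x. \<bar>x\<bar> \<ge> e \<longrightarrow> \<psi> x = 0)"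
proof -
  obtain \<psi> :: "real \<Rightarrow> real" where \<psi>: "\<And>k. C_k k \<psi>" "\<And>x. \<psi> x \<ge> 0" "\<psi> 0 > 0" "\<And>x. \<bar>x\<bar> \<ge> e \<Longrightarrow> \<psi> x = 0"
    using smooth_bump_exists[OF e] by metis
  have cont: "continuous_on UNIV \<psi>"
    using \<psi>(1)[of 0] by simp
  then have "isCont \<psi> x" for x
    by (simp add: continuous_on_eq_continuous_at)
  then obtain F where F: "\<And>x. (F has_real_derivative \<psi> x) (at x)"
    using einterval_antiderivative[of "-\<infinity>" "\<infinity>" \<psi>]
    by (auto simp: has_real_derivative_iff_has_vector_derivative)
  have F_eq: "F x = F y" if "\<forall>z\<in>I. \<psi> z = 0" "convex I" "x \<in> I" "y \<in> I" for x y I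
  proof -
    have "\<exists>c. \<forall>x\<in>I. F x = c"
      using that F by (intro has_field_derivative_zero_constant)
        (metis has_field_derivative_at_within)+
    then show ?thesis using that by metis
  qed
  have left: "F x = F (- e)" if "x \<le> - e" for x
    by (rule F_eq[where I = "{..-e}"]) (use that \<psi>(4) e in auto)
  have right: "F x = F e" if "x \<ge> e" for x
    by (rule F_eq[where I = "{e..}"]) (use that \<psi>(4) e in auto)
  define \<phi> where "\<phi> t = F (t - a) - F (t - b)" for t
  have der: "(\<phi> has_real_derivative \<psi> (t - a) - \<psi> (t - b)) (at t)" for t
    unfolding \<phi>_def by (auto intro!: derivative_eq_intros DERIV_chain2[OF F])
  have "C_k k (\<lambda>t. 1 * \<psi> (1 * t + (- a)) + (- 1) * \<psi> (1 * t + (- b)))" for k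
    by (intro C_k_add_real C_k_affine_real \<psi>)
  then have "C_k (Suc k) \<phi>" for k
    using C_k_Suc_real[OF der] by simp
  then have Ck: "C_k k \<phi>" for k
    using C_k_SucD by blast
  let ?I = "{min a b - e..max a b + e}"
  have "\<phi> t = 0" if "t \<notin> ?I" for t
  proof (cases "t < min a b - e")
    case True
    then show ?thesis using left[of "t - a"] left[of "t - b"] by (auto simp: \<phi>_def)
  next
    case False
    then have "t > max a b + e" using that by auto
    then show ?thesis using right[of "t - a"] right[of "t - b"] by (auto simp: \<phi>_def)
  qed
  then have "{t. \<phi> t \<noteq> 0} \<subseteq> ?I"
    by blast
  then have sub: "closure {t. \<phi> t \<noteq> 0} \<subseteq> ?I"
    by (rule closure_minimal) simp
  have "?I \<subseteq> {S<..<T}" using ab by auto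
  moreover have "compact (closure {t. \<phi> t \<noteq> 0})"
    using bounded_subset[OF bounded_closed_interval sub] by (simp add: compact_eq_bounded_closed)
  ultimately have "test_function {S<..<T} \<phi>"
    using Ck sub by (simp add: test_function_def)
  then show ?thesis
    using der cont \<psi> by (intro exI[of _ \<phi>] exI[of _ \<psi>]) auto
qed

lemma du_Bois_Reymond:
  fixes m :: "real \<Rightarrow> real"
  assumes "S < T" and m: "continuous_on {S..T} m"
    and weak: "\<And>\<phi>. test_function {S<..<T} \<phi> \<Longrightarrow> (LINT t|lebesgue_on {S..T}. m t * deriv \<phi> t) = 0"
  shows "m constant_on {S..T}"
proof -
  \<comment> \<open>No order between \<open>a\<close> and \<open>b\<close> is assumed, so exchanging
    them also excludes \<open>m a > m b\<close>.\<close>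
  have False if a: "a \<in> {S<..<T}" and b: "b \<in> {S<..<T}" and less: "m a < m b" for a b
  proof -
    define c where "c = (m a + m b) / 2"
    have c: "m a < c" "c < m b" using less by (auto simp: c_def)
    have "isCont m a" "isCont m b"
      using m a b continuous_on_interior[of "{S..T}" m] by auto
    then have "\<forall>\<^sub>F t in at a. m t < c" "\<forall>\<^sub>F t in at b. c < m t"
      using c by (auto simp: isCont_def intro: order_tendstoD)
    then obtain d1 d2 where d: "d1 > 0" "d2 > 0"
      "\<And>t. \<bar>t - a\<bar> < d1 \<Longrightarrow> m t < c" "\<And>t. \<bar>t - b\<bar> < d2 \<Longrightarrow> c < m t"
      using c by (auto simp: eventually_at dist_real_def) (metis)
    \<comment> \<open>Half of a positive lower bound of these numbers is a bump radius that respects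
      both neighbourhoods and both endpoints with strict inequality.\<close>
    let ?R = "{d1, d2, a - S, T - a, b - S, T - b}"
    have "0 < Min ?R"
      using d(1,2) a b by (subst Min_gr_iff) auto
    moreover have "\<forall>r\<in>?R. Min ?R \<le> r"
      by (intro ballI Min_le) auto
    ultimately obtain r where "0 < r" "\<forall>s\<in>?R. r \<le> s"
      by metis
    moreover define e where "e = r / 2"
    ultimately have e: "e > 0" "e < d1" "e < d2" "S < a - e" "a + e < T" "S < b - e" "b + e < T"
      by auto
    obtain \<phi> \<psi> where test: "test_function {S<..<T} \<phi>"
      and der: "\<And>t. (\<phi> has_real_derivative \<psi> (t - a) - \<psi> (t - b)) (at t)"
      and \<psi>: "continuous_on UNIV \<psi>" "\<And>x. \<psi> x \<ge> 0" "\<psi> 0 > 0" "\<And>x. \<bar>x\<bar> \<ge> e \<Longrightarrow> \<psi> x = 0"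
      using test_function_difference_of_bumps[OF e(1,4-7)] by (elim exE conjE) blast
    define g where "g t = \<psi> (t - a) - \<psi> (t - b)" for t
    have deriv: "deriv \<phi> = g"
      using der by (auto simp: g_def DERIV_imp_deriv)
    have contg: "continuous_on {S..T} g"
      unfolding g_def by (intro continuous_intros continuous_on_compose2[OF \<psi>(1)]) auto
    have zero: "\<phi> t = 0" if "t \<notin> {S<..<T}" for t
    proof -
      have "{t. \<phi> t \<noteq> 0} \<subseteq> {S<..<T}"
        using test order_trans[OF closure_subset] unfolding test_function_def by blast
      then show ?thesis using that by blast
    qed
    \<comment> \<open>Since \<open>\<phi>\<close> vanishes at both endpoints, \<open>g\<close> has
      integral zero, and \<open>m\<close> may be replaced by \<open>c - m\<close> in the weak
      identity.\<close>
    have "(g has_integral \<phi> T - \<phi> S) {S..T}"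
      using der \<open>S < T\<close> by (intro fundamental_theorem_of_calculus)
        (auto simp: g_def has_real_derivative_iff_has_vector_derivative[symmetric]
          intro: has_field_derivative_at_within)
    then have "integral {S..T} g = 0"
      using zero by (simp add: integral_unique)
    then have "(LINT t|lebesgue_on {S..T}. g t) = 0"
      using contg by (simp add: continuous_imp_integrable_real lebesgue_integral_eq_integral)
    moreover have "(LINT t|lebesgue_on {S..T}. m t * g t) = 0"
      using weak[OF test] by (simp add: deriv)
    moreover have "integrable (lebesgue_on {S..T}) g" "integrable (lebesgue_on {S..T}) (\<lambda>t. m t * g t)"
      by (intro continuous_imp_integrable_real contg continuous_intros m)+
    ultimately have "(LINT t|lebesgue_on {S..T}. c * g t - m t * g t) = 0"
      by simp
    moreover have "continuous_on {S..T} (\<lambda>t. c * g t - m t * g t)"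
      by (intro contg continuous_intros m)
    \<comment> \<open>The integrand is
      \<open>(c - m t) * \<psi> (t - a) + (m t - c) * \<psi> (t - b)\<close>, and each bump lives
      where its coefficient is positive.\<close>
    moreover have nonneg: "c * g t - m t * g t \<ge> 0" for t
    proof -
      have "(c - m t) * \<psi> (t - a) \<ge> 0" "(m t - c) * \<psi> (t - b) \<ge> 0"
        using d(3,4)[of t] \<psi>(2)[of "t - a"] \<psi>(2)[of "t - b"] \<psi>(4)[of "t - a"] \<psi>(4)[of "t - b"] e(2,3)
        by (cases "\<bar>t - a\<bar> < e"; cases "\<bar>t - b\<bar> < e"; auto)+
      then show ?thesis by (simp add: g_def algebra_simps)
    qed
    ultimately have "\<forall>t\<in>{S..T}. c * g t - m t * g t = 0"
      using integralL_eq_0_iff[of S T "\<lambda>t. c * g t - m t * g t"] \<open>S < T\<close> by simp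
    then have "(c - m a) * g a = 0"
      using a by (auto simp: algebra_simps)
    \<comment> \<open>The vanishing integrand at \<open>t = a\<close> forces the bump around
      \<open>b\<close> to be positive at \<open>a\<close>. Then \<open>a\<close> lies in both
      neighbourhoods, where \<open>m a < c\<close> and \<open>c < m a\<close>.\<close>
    then have "\<psi> 0 = \<psi> (a - b)"
      using c by (auto simp: g_def)
    then have "\<bar>a - b\<bar> < e"
      using \<psi>(3,4) by (metis less_irrefl not_less)
    then show False
      using d(3)[of a] d(4)[of a] d(1) e(3) by auto
  qed
  then have eq: "m a = m b" if "a \<in> {S<..<T}" "b \<in> {S<..<T}" for a b
    using that by (meson linorder_neqE_linordered_idom)
  have mid: "(S + T) / 2 \<in> {S<..<T}" using \<open>S < T\<close> by auto
  \<comment> \<open>Constancy on the open interval passes to its closure by continuity.\<close>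
  have "m t = m ((S + T) / 2)" if "t \<in> {S..T}" for t
    by (rule continuous_constant_on_closure[of "{S<..<T}" m, OF _ eq[OF _ mid]])
      (use that m \<open>S < T\<close> in simp_all)
  then show ?thesis unfolding constant_on_def by blast
qed

section \<open>Constants in the Sobolev space and continuity of the mean\<close>

lemma integral_lborel_translate:
  fixes f :: "'a::euclidean_space \<Rightarrow> real"
  assumes [measurable]: "f \<in> borel_measurable borel"
  shows "(LINT x|lborel. f (c + x)) = (LINT x|lborel. f x)"
proof -
  have "(LINT x|lborel. f x) = (LINT x|distr lborel borel ((+) c). f x)"
    by (simp add: lborel_distr_plus)
  also have "\<dots> = (LINT x|lborel. f (c + x))"
    by (rule integral_distr) auto
  finally show ?thesis by simp
qed

text \<open>By translation invariance the difference quotients have integral zero; they converge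
  boundedly to the derivative.\<close>

lemma integral_directional_derivative_compact_support:
  fixes \<phi> :: "'a::euclidean_space \<Rightarrow> real"
  assumes diff: "\<And>x. \<phi> differentiable (at x)"
    and cont: "continuous_on UNIV (\<lambda>x. frechet_derivative \<phi> (at x) v)"
    and supp: "bounded {x. \<phi> x \<noteq> 0}"
  shows "(LINT x|lborel. frechet_derivative \<phi> (at x) v) = 0"
proof -
  define g where "g x = frechet_derivative \<phi> (at x) v" for x
  have [measurable]: "g \<in> borel_measurable borel"
    using cont by (simp add: g_def borel_measurable_continuous_onI)
  have contphi: "continuous_on UNIV \<phi>"
    using diff by (auto intro!: continuous_at_imp_continuous_on differentiable_imp_continuous_within)
  then have [measurable]: "\<phi> \<in> borel_measurable borel"
    by (rule borel_measurable_continuous_onI)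
  obtain R where R: "R > 0" "\<And>x. \<phi> x \<noteq> 0 \<Longrightarrow> norm x \<le> R"
    using supp by (auto simp: bounded_pos)
  \<comment> \<open>Beyond radius \<open>R'\<close>, both \<open>x\<close> and its translate by at
    most \<open>v\<close> lie outside the support, so the difference quotient is 0. Within it, the
    mean value point has norm at most \<open>R' + norm v\<close>, which is why \<open>g\<close> is
    bounded on that larger ball.\<close>
  define R' where "R' = R + norm v"
  have "compact (cball (0::'a) (R' + norm v))" by simp
  then have "bounded (g ` cball 0 (R' + norm v))"
    using cont by (intro compact_imp_bounded compact_continuous_image)
      (auto simp: g_def intro: continuous_on_subset)
  then obtain B where B: "\<And>x. norm x \<le> R' + norm v \<Longrightarrow> \<bar>g x\<bar> \<le> B"
    unfolding bounded_iff by (metis imageI mem_cball_0 real_norm_def)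
  define q where "q n x = real (Suc n) * (\<phi> ((1 / real (Suc n)) *\<^sub>R v + x) - \<phi> x)" for n x
  have dphi: "(\<phi> has_derivative frechet_derivative \<phi> (at x)) (at x)" for x
    using diff frechet_derivative_works by blast
  have line: "((\<lambda>s. \<phi> (s *\<^sub>R v + x)) has_real_derivative g (s *\<^sub>R v + x)) (at s)" for s x
  proof -
    have "((\<lambda>s. s *\<^sub>R v + x) has_derivative (\<lambda>h. h *\<^sub>R v)) (at s)"
      by (auto intro!: derivative_eq_intros)
    from has_derivative_compose[OF this dphi]
    show ?thesis
      using linear_frechet_derivative[OF diff, of "s *\<^sub>R v + x"]
      by (simp add: has_field_derivative_def g_def linear_cmul fun_eq_iff mult.commute[of _ "frechet_derivative _ _ _"])
  qed
  have lim: "(\<lambda>n. q n x) \<longlonglongrightarrow> g x" for x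
  proof -
    have "((\<lambda>s. (\<phi> (s *\<^sub>R v + x) - \<phi> x) / s) \<longlongrightarrow> g x) (at 0)"
      using line[of x 0] by (simp add: has_field_derivative_iff)
    moreover have "filterlim (\<lambda>n. 1 / real (Suc n)) (at 0) sequentially"
      using LIMSEQ_Suc[OF lim_1_over_n] by (auto simp: filterlim_at)
    ultimately have "(\<lambda>n. (\<phi> ((1 / real (Suc n)) *\<^sub>R v + x) - \<phi> x) / (1 / real (Suc n))) \<longlonglongrightarrow> g x"
      by (rule filterlim_compose)
    then show ?thesis by (simp add: q_def mult.commute)
  qed
  have bound: "\<bar>q n x\<bar> \<le> B * indicator (cball 0 R') x" for n x
  proof (cases "norm x \<le> R'")
    case True
    let ?h = "1 / real (Suc n)"
    obtain s where s: "0 < s" "s < ?h"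
      "\<phi> (?h *\<^sub>R v + x) - \<phi> (0 *\<^sub>R v + x) = (?h - 0) * g (s *\<^sub>R v + x)"
      using MVT2[of 0 ?h "\<lambda>s. \<phi> (s *\<^sub>R v + x)" "\<lambda>s. g (s *\<^sub>R v + x)"] line by auto
    have "?h \<le> 1" by simp
    then have "s \<le> 1" using s by linarith
    then have "norm (s *\<^sub>R v) \<le> norm v" using s by (simp add: mult_left_le_one_le)
    then have "norm (s *\<^sub>R v + x) \<le> R' + norm v"
      using norm_triangle_ineq[of "s *\<^sub>R v" x] True by linarith
    moreover have "q n x = g (s *\<^sub>R v + x)" using s(3) by (simp add: q_def)
    ultimately show ?thesis using B(1) True by simp
  next
    case False
    have "norm ((1 / real (Suc n)) *\<^sub>R v) \<le> norm v"
      by (simp add: mult_left_le_one_le divide_le_eq mult_le_cancel_left1)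
    then have "norm ((1 / real (Suc n)) *\<^sub>R v + x) > R"
      using False norm_triangle_ineq2[of x "- ((1 / real (Suc n)) *\<^sub>R v)"] by (simp add: R'_def add.commute)
    moreover have "norm x > R" using False norm_ge_zero[of v] unfolding R'_def by linarith
    ultimately have "q n x = 0" using R(2) by (metis diff_self mult_zero_right not_less q_def)
    then show ?thesis using False by simp
  qed
  have int_phi: "integrable lborel \<phi>"
  proof -
    have "integrable lborel (\<lambda>x. indicator (cball 0 R) x *\<^sub>R \<phi> x)"
      using contphi by (intro borel_integrable_compact) (auto intro: continuous_on_subset)
    moreover have "(\<lambda>x. indicator (cball 0 R) x *\<^sub>R \<phi> x) = \<phi>"
      using R by (auto simp: indicator_def fun_eq_iff)
    ultimately show ?thesis by simp
  qed
  have int0: "(LINT x|lborel. q n x) = 0" for n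
  proof -
    have "integrable lborel (\<lambda>x. \<phi> ((1 / real (Suc n)) *\<^sub>R v + x))"
    proof -
      have "integrable (distr lborel borel ((+) ((1 / real (Suc n)) *\<^sub>R v))) \<phi>"
        using int_phi by (simp add: lborel_distr_plus)
      then show ?thesis by (rule integrable_distr[rotated]) simp
    qed
    then show ?thesis
      using int_phi unfolding q_def by (simp add: integral_lborel_translate)
  qed
  have "(\<lambda>n. LINT x|lborel. q n x) \<longlonglongrightarrow> (LINT x|lborel. g x)"
  proof (rule integral_dominated_convergence)
    show "integrable lborel (\<lambda>x. B * indicator (cball (0::'a) R') x)"
      using emeasure_bounded_finite[of "cball (0::'a) R'"] by simp
    show "q n \<in> borel_measurable lborel" for n unfolding q_def by simp
  qed (use lim bound in auto)
  then show ?thesis using int0 LIMSEQ_unique by (simp add: g_def LIMSEQ_const_iff)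
qed

lemma test_functionD:
  assumes "test_function U \<phi>"
  shows "\<phi> differentiable (at x)" "b \<in> Basis \<Longrightarrow> continuous_on UNIV (\<lambda>x. frechet_derivative \<phi> (at x) b)"
    "bounded {x. \<phi> x \<noteq> 0}"
proof -
  have "C_k (Suc 0) \<phi>" "compact (closure {x. \<phi> x \<noteq> 0})" using assms by (auto simp: test_function_def)
  then show "\<phi> differentiable (at x)" "b \<in> Basis \<Longrightarrow> continuous_on UNIV (\<lambda>x. frechet_derivative \<phi> (at x) b)"
    "bounded {x. \<phi> x \<noteq> 0}"
    by (auto simp: compact_closure)
qed

text \<open>The support is a closed subset of \<open>U\<close>, so \<open>\<phi>\<close> vanishes
  near every point outside \<open>U\<close>. Its derivative is therefore zero there, and the
  integral over \<open>U\<close> is one over the whole space.\<close>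

lemma integral_partial_test_function:
  fixes \<phi> :: "'a::euclidean_space \<Rightarrow> real"
  assumes "U \<in> sets lebesgue" "test_function U \<phi>" "b \<in> Basis"
  shows "(LINT x|lebesgue_on U. frechet_derivative \<phi> (at x) b) = 0"
proof -
  let ?g = "\<lambda>x. frechet_derivative \<phi> (at x) b"
  note \<phi> = test_functionD[OF assms(2)]
  have zero: "?g x = 0" if "x \<notin> U" for x
  proof -
    let ?C = "closure {x. \<phi> x \<noteq> 0}"
    have "x \<in> - ?C" using assms(2) that by (auto simp: test_function_def)
    moreover have "open (- ?C)" by (simp add: open_Compl)
    moreover have "\<phi> y = 0" if "y \<in> - ?C" for y using that closure_subset[of "{x. \<phi> x \<noteq> 0}"] by auto
    ultimately have "frechet_derivative \<phi> (at x) = frechet_derivative (\<lambda>_. 0) (at x)"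
      using \<phi>(1) by (intro frechet_derivative_transform_within_open[where X = "- ?C"]) blast+
    then show ?thesis by simp
  qed
  have "(LINT x|lebesgue_on U. ?g x) = (LINT x|lebesgue. indicator U x *\<^sub>R ?g x)"
    using assms(1) by (intro integral_restrict_space) simp
  also have "(\<lambda>x. indicator U x *\<^sub>R ?g x) = ?g"
    using zero by (auto simp: indicator_def fun_eq_iff)
  also have "(LINT x|lebesgue. ?g x) = (LINT x|lborel. ?g x)"
    using \<phi>(2)[OF assms(3)] by (intro integral_completion) (simp add: borel_measurable_continuous_onI)
  also have "\<dots> = 0"
    using \<phi> assms(3) by (intro integral_directional_derivative_compact_support) auto
  finally show ?thesis .
qed

lemma planar_domain_finite_measure:
  assumes "planar_domain \<Omega>"
  shows "finite_measure (lebesgue_on \<Omega>)"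
  using assms by (simp add: planar_domain_def bounded_set_imp_lmeasurable finite_measure_lebesgue_on)

lemma weak_gradient_const:
  assumes "planar_domain \<Omega>"
  shows "weak_gradient \<Omega> (\<lambda>x. c) (\<lambda>x. 0)"
proof -
  interpret finite_measure "lebesgue_on \<Omega>" by (rule planar_domain_finite_measure[OF assms])
  have "\<Omega> \<in> sets lebesgue"
    using assms by (simp add: planar_domain_def)
  then show ?thesis
    by (auto simp: weak_gradient_def L2_def integral_partial_test_function axis_in_Basis_iff)
qed

section \<open>Cauchy-Schwarz and continuity of the integral in time\<close>

lemma L2_diff:
  assumes "f \<in> L2 \<Omega>" "g \<in> L2 \<Omega>"
  shows "(\<lambda>x. f x - g x) \<in> L2 \<Omega>"
proof -
  have [measurable]: "f \<in> borel_measurable (lebesgue_on \<Omega>)" "g \<in> borel_measurable (lebesgue_on \<Omega>)"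
    using assms by (auto simp: L2_def)
  have "integrable (lebesgue_on \<Omega>) (\<lambda>x. (f x - g x)\<^sup>2)"
  proof (rule Bochner_Integration.integrable_bound)
    show "integrable (lebesgue_on \<Omega>) (\<lambda>x. 2 * (f x)\<^sup>2 + 2 * (g x)\<^sup>2)"
      using assms by (auto simp: L2_def)
    have "(f x - g x)\<^sup>2 \<le> 2 * (f x)\<^sup>2 + 2 * (g x)\<^sup>2" for x
      using zero_le_power2[of "f x + g x"] by (simp add: power2_eq_square algebra_simps)
    then show "AE x in lebesgue_on \<Omega>. norm ((f x - g x)\<^sup>2) \<le> norm (2 * (f x)\<^sup>2 + 2 * (g x)\<^sup>2)"
      by simp
  qed simp
  then show ?thesis by (simp add: L2_def)
qed

lemma L2_integrable:
  assumes "finite_measure (lebesgue_on \<Omega>)" "f \<in> L2 \<Omega>"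
  shows "integrable (lebesgue_on \<Omega>) f"
proof (rule Bochner_Integration.integrable_bound)
  interpret finite_measure "lebesgue_on \<Omega>" by fact
  show "integrable (lebesgue_on \<Omega>) (\<lambda>x. 1 + (f x)\<^sup>2)"
    using assms by (auto simp: L2_def)
  have "\<bar>y\<bar> \<le> 1 + y\<^sup>2" for y :: real
    using zero_le_power2[of "\<bar>y\<bar> - 1"] by (simp add: power2_eq_square algebra_simps)
  then show "AE x in lebesgue_on \<Omega>. norm (f x) \<le> norm (1 + (f x)\<^sup>2)"
    by (simp add: abs_of_nonneg)
qed (use assms in \<open>simp add: L2_def\<close>)

text \<open>Cauchy-Schwarz against the constant 1. With area \<open>A\<close>, integral
  \<open>I\<close> and square integral \<open>Q\<close>, integrating
  \<open>(A * f x - I)\<^sup>2\<close> gives \<open>0 \<le> A * (A * Q - I\<^sup>2)\<close>; the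
  case \<open>A = 0\<close> is a null space, where \<open>I = 0\<close>.\<close>

lemma abs_integral_le_L2_norm:
  assumes "finite_measure (lebesgue_on \<Omega>)" "f \<in> L2 \<Omega>"
  shows "\<bar>LINT x|lebesgue_on \<Omega>. f x\<bar> \<le> sqrt (measure (lebesgue_on \<Omega>) \<Omega>) * L2_norm \<Omega> f"
proof -
  interpret finite_measure "lebesgue_on \<Omega>" by fact
  define A where "A = measure (lebesgue_on \<Omega>) \<Omega>"
  define I where "I = (LINT x|lebesgue_on \<Omega>. f x)"
  define Q where "Q = (LINT x|lebesgue_on \<Omega>. (f x)\<^sup>2)"
  have int: "integrable (lebesgue_on \<Omega>) f" "integrable (lebesgue_on \<Omega>) (\<lambda>x. (f x)\<^sup>2)"
    using L2_integrable[OF assms] assms(2) by (auto simp: L2_def)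
  have expand: "0 \<le> A\<^sup>2 * Q - 2 * A * I * I + I\<^sup>2 * A"
  proof -
    have "0 \<le> (LINT x|lebesgue_on \<Omega>. (A * f x - I)\<^sup>2)" by simp
    also have "(\<lambda>x. (A * f x - I)\<^sup>2) = (\<lambda>x. A\<^sup>2 * (f x)\<^sup>2 - 2 * A * I * f x + I\<^sup>2)"
      by (auto simp: power2_eq_square algebra_simps)
    also have "(LINT x|lebesgue_on \<Omega>. \<dots> x) = A\<^sup>2 * Q - 2 * A * I * I + I\<^sup>2 * A"
      using int by (simp add: I_def Q_def A_def)
    finally show ?thesis .
  qed
  have "I\<^sup>2 \<le> A * Q"
  proof (cases "A = 0")
    case True
    then have "AE x in lebesgue_on \<Omega>. False"
      by (intro AE_I[of _ _ \<Omega>]) (use emeasure_eq_measure in \<open>auto simp: A_def\<close>)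
    then have "I = 0" unfolding I_def by (intro integral_eq_zero_AE) auto
    then show ?thesis using True by simp
  next
    case False
    then have "A > 0" by (simp add: A_def less_le)
    moreover have "0 \<le> A * (A * Q - I\<^sup>2)" using expand by (simp add: power2_eq_square algebra_simps)
    ultimately show ?thesis by (simp add: zero_le_mult_iff)
  qed
  then have "\<bar>I\<bar> \<le> sqrt (A * Q)" by (metis real_sqrt_abs real_sqrt_le_mono)
  then show ?thesis by (simp add: real_sqrt_mult A_def I_def Q_def L2_norm_def)
qed

lemma continuous_on_integral_C_X0:
  assumes fin: "finite_measure (lebesgue_on \<Omega>)" and u: "u \<in> C_X0 \<Omega> T"
  shows "continuous_on {0..T} (\<lambda>t. LINT x|lebesgue_on \<Omega>. u t x $ i)"
  unfolding continuous_on_def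
proof
  fix s assume s: "s \<in> {0..T}"
  let ?m = "\<lambda>t. LINT x|lebesgue_on \<Omega>. u t x $ i"
  let ?C = "sqrt (measure (lebesgue_on \<Omega>) \<Omega>)"
  have L2: "(\<lambda>x. u t x $ i) \<in> L2 \<Omega>" if "t \<in> {0..T}" for t
    using u that by (auto simp: C_X0_def X0_def)
  have bound: "\<bar>?m t - ?m s\<bar> \<le> ?C * X0_norm \<Omega> (u t - u s)" if t: "t \<in> {0..T}" for t
  proof -
    have "?m t - ?m s = (LINT x|lebesgue_on \<Omega>. u t x $ i - u s x $ i)"
      using L2_integrable[OF fin L2] s t by simp
    then have "\<bar>?m t - ?m s\<bar> \<le> ?C * L2_norm \<Omega> (\<lambda>x. u t x $ i - u s x $ i)"
      using abs_integral_le_L2_norm[OF fin L2_diff[OF L2 L2]] s t by simp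
    \<comment> \<open>A single component is one of the nonnegative terms under the root in
      \<open>X0_norm\<close>.\<close>
    also have "L2_norm \<Omega> (\<lambda>x. u t x $ i - u s x $ i) \<le> X0_norm \<Omega> (u t - u s)"
      unfolding X0_norm_def
      by (rule real_le_rsqrt, rule order_trans[OF _ member_le_sum[of i]]) auto
    finally show ?thesis by (simp add: mult_left_mono)
  qed
  have "((\<lambda>t. ?C * X0_norm \<Omega> (u t - u s)) \<longlongrightarrow> ?C * 0) (at s within {0..T})"
    using u s by (intro tendsto_intros) (auto simp: C_X0_def)
  then have lim: "((\<lambda>t. ?C * X0_norm \<Omega> (u t - u s)) \<longlongrightarrow> 0) (at s within {0..T})"
    by simp
  have "((\<lambda>t. ?m t - ?m s) \<longlongrightarrow> 0) (at s within {0..T})"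
  proof (rule Lim_null_comparison[OF _ lim])
    show "\<forall>\<^sub>F t in at s within {0..T}. norm (?m t - ?m s) \<le> ?C * X0_norm \<Omega> (u t - u s)"
      unfolding eventually_at_filter real_norm_def by (intro always_eventually allI impI bound)
  qed
  then show "(?m \<longlongrightarrow> ?m s) (at s within {0..T})"
    by (rule Lim_null[THEN iffD2])
qed

section \<open>Conservation of the mean\<close>

text \<open>Testing the weak formulation with a coordinate vector field removes the diffusion term and,
  by linearity, the pairing with the other time derivative.\<close>

lemma weak_solution_time_derivative_pairing_const:
  assumes dom: "planar_domain \<Omega>" and sol: "weak_solution \<Omega> D T u0 u"
  obtains p where "time_derivative \<Omega> T (\<lambda>t x. u t x $ i) p"
    "AE t in lebesgue_on {0..T}. p t (\<lambda>x. 1) = 0"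
proof -
  obtain p q where p: "time_derivative \<Omega> T (\<lambda>t x. u t x $ 1) p"
    and q: "time_derivative \<Omega> T (\<lambda>t x. u t x $ 2) q"
    and eq: "AE t in lebesgue_on {0..T}. \<forall>Ju w Jw. weak_jacobian \<Omega> (u t) Ju \<longrightarrow> weak_jacobian \<Omega> w Jw \<longrightarrow>
           p t (\<lambda>x. w x $ 1) + q t (\<lambda>x. w x $ 2) +
           (LINT x|lebesgue_on \<Omega>. trace (transpose (Jw x) ** D (u t x) ** Ju x)) = 0"
    using sol unfolding weak_solution_def by blast
  have const: "(\<lambda>x. c) \<in> H1 \<Omega>" for c
    using weak_gradient_const[OF dom] by (auto simp: H1_def)
  have dual0: "l (\<lambda>x. 0) = 0" if "l \<in> H1_dual \<Omega>" for l
  proof -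
    \<comment> \<open>Linearity is stated for combinations of two functions; both coefficients are
      taken to be 0.\<close>
    have "l (\<lambda>x. 0 * 0 + 0 * 0) = 0 * l (\<lambda>x. 0) + 0 * l (\<lambda>x. 0)"
      using that const[of 0] by (simp only: H1_dual_def mem_Collect_eq)
    then show ?thesis by simp
  qed
  have "AE t in lebesgue_on {0..T}. u t \<in> X1 \<Omega>"
    using sol by (auto simp: weak_solution_def L2_time_def)
  moreover have "AE t in lebesgue_on {0..T}. p t \<in> H1_dual \<Omega>" "AE t in lebesgue_on {0..T}. q t \<in> H1_dual \<Omega>"
    using p q by (auto simp: time_derivative_def L2_time_def)
  ultimately have "AE t in lebesgue_on {0..T}. p t (\<lambda>x. 1) = 0 \<and> q t (\<lambda>x. 1) = 0"
    using eq
  proof eventually_elim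
    case (elim t)
    have "\<forall>i. \<exists>g. weak_gradient \<Omega> (\<lambda>x. u t x $ i) g"
      using elim(1) by (simp add: X1_def H1_def)
    then obtain G where "\<And>i. weak_gradient \<Omega> (\<lambda>x. u t x $ i) (G i)"
      by metis
    \<comment> \<open>The weak equation is conditional on a Jacobian of \<open>u t\<close>, so one
      is assembled from the gradients of the components.\<close>
    then have Ju: "weak_jacobian \<Omega> (u t) (\<lambda>x. \<chi> i. G i x)"
      by (simp add: weak_jacobian_def)
    have "weak_jacobian \<Omega> (\<lambda>x. c) (\<lambda>x. 0)" for c
      by (simp add: weak_jacobian_def weak_gradient_const[OF dom])
    then have *: "p t (\<lambda>x. c $ 1) + q t (\<lambda>x. c $ 2) +
           (LINT x|lebesgue_on \<Omega>. trace (transpose 0 ** D (u t x) ** (\<chi> i. G i x))) = 0" for c :: "real^2"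
      using elim(4) Ju by blast
    have "transpose 0 = (0 :: real^2^2)"
      by (simp add: transpose_def vec_eq_iff)
    then have "p t (\<lambda>x. c $ 1) + q t (\<lambda>x. c $ 2) = 0" for c :: "real^2"
      using *[of c] by (simp add: trace_def)
    \<comment> \<open>Each coordinate vector keeps one pairing with 1 and turns the other into a
      pairing with the zero function.\<close>
    from this[of "axis 1 1"] this[of "axis 2 1"] show ?case
      using elim(2,3) by (simp add: dual0 axis_def)
  qed
  then have "AE t in lebesgue_on {0..T}. p t (\<lambda>x. 1) = 0" "AE t in lebesgue_on {0..T}. q t (\<lambda>x. 1) = 0"
    by auto
  then show thesis
    using that p q exhaust_2[of i] by metis
qed

lemma weak_solution_integral_const:
  assumes dom: "planar_domain \<Omega>" and "T > 0" and sol: "weak_solution \<Omega> D T u0 u"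
  shows "(\<lambda>t. LINT x|lebesgue_on \<Omega>. u t x $ i) constant_on {0..T}"
proof (rule du_Bois_Reymond)
  show "continuous_on {0..T} (\<lambda>t. LINT x|lebesgue_on \<Omega>. u t x $ i)"
    using continuous_on_integral_C_X0[OF planar_domain_finite_measure[OF dom]] sol
    by (simp add: weak_solution_def)
  fix \<phi> :: "real \<Rightarrow> real" assume \<phi>: "test_function {0<..<T} \<phi>"
  obtain p where p: "time_derivative \<Omega> T (\<lambda>t x. u t x $ i) p"
    and zero: "AE t in lebesgue_on {0..T}. p t (\<lambda>x. 1) = 0"
    using weak_solution_time_derivative_pairing_const[OF dom sol] .
  have "(\<lambda>x. 1) \<in> H1 \<Omega>"
    using weak_gradient_const[OF dom] by (auto simp: H1_def)
  then have "(LINT t|lebesgue_on {0..T}. p t (\<lambda>x. 1) * \<phi> t) =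
      - (LINT t|lebesgue_on {0..T}. (LINT x|lebesgue_on \<Omega>. u t x $ i * 1) * deriv \<phi> t)"
    using p \<phi> unfolding time_derivative_def by blast
  moreover have "(LINT t|lebesgue_on {0..T}. p t (\<lambda>x. 1) * \<phi> t) = 0"
    by (rule integral_eq_zero_AE) (use zero in auto)
  ultimately show "(LINT t|lebesgue_on {0..T}. (LINT x|lebesgue_on \<Omega>. u t x $ i) * deriv \<phi> t) = 0"
    by simp
qed (use assms in auto)

lemma weak_solution_mean_vector:
  assumes dom: "planar_domain \<Omega>" and "T > 0" and sol: "weak_solution \<Omega> D T u0 u"
    and u0: "u0 \<in> X1 \<Omega>" and t: "t \<in> {0..T}"
  shows "mean_vector \<Omega> (u t) = mean_vector \<Omega> u0"
proof -
  have "(LINT x|lebesgue_on \<Omega>. u t x $ i) = (LINT x|lebesgue_on \<Omega>. u0 x $ i)" for i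
  proof -
    have "(LINT x|lebesgue_on \<Omega>. u t x $ i) = (LINT x|lebesgue_on \<Omega>. u 0 x $ i)"
      using weak_solution_integral_const[OF dom \<open>T > 0\<close> sol, of i] t \<open>T > 0\<close>
      by (auto simp: constant_on_def)
    also have "\<dots> = (LINT x|lebesgue_on \<Omega>. u0 x $ i)"
    \<comment> \<open>The initial condition holds almost everywhere only, so equality of the
      integrals also needs measurability of both sides.\<close>
    proof (rule integral_cong_AE)
      have "u 0 \<in> X0 \<Omega>"
        using sol \<open>T > 0\<close> by (simp add: weak_solution_def C_X0_def)
      then show "(\<lambda>x. u 0 x $ i) \<in> borel_measurable (lebesgue_on \<Omega>)"
        by (simp add: X0_def L2_def)
      show "(\<lambda>x. u0 x $ i) \<in> borel_measurable (lebesgue_on \<Omega>)"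
        using u0 by (auto simp: X1_def H1_def weak_gradient_def L2_def)
      show "AE x in lebesgue_on \<Omega>. u 0 x $ i = u0 x $ i"
        using sol by (auto simp: weak_solution_def)
    qed
    finally show ?thesis .
  qed
  then show ?thesis by (simp add: mean_vector_def mean_def)
qed

theorem lemma3:
  fixes \<Omega> :: "(real^2) set" and D :: "real^2 \<Rightarrow> real^2^2" and u0 :: "real^2 \<Rightarrow> real^2"
  assumes "planar_domain \<Omega>"
    and "D_elliptic D" and "D_lipschitz D" and "D_bounded D"
    and "u0 \<in> X1 \<Omega>"
  shows "(\<forall>T>0. \<forall>u. weak_solution \<Omega> D T u0 u \<longrightarrow>
            (\<forall>t\<in>{0..T}. mean_vector \<Omega> (u t) = mean_vector \<Omega> u0)) \<and>
         (well_posed \<Omega> D u0 \<longrightarrow>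
            (\<forall>t\<ge>0. mean_vector \<Omega> (scale_space \<Omega> D t u0) = mean_vector \<Omega> u0))"
proof (intro conjI allI impI ballI)
  fix T u t assume "T > 0" "weak_solution \<Omega> D T u0 u" "t \<in> {0..T}"
  then show "mean_vector \<Omega> (u t) = mean_vector \<Omega> u0"
    using weak_solution_mean_vector assms(1,5) by blast
next
  fix t :: real assume wp: "well_posed \<Omega> D u0" and t: "t \<ge> 0"
  \<comment> \<open>The horizon \<open>t + 1\<close> exceeds \<open>t\<close> and is positive even
    for \<open>t = 0\<close>. Existence of this solution makes the \<open>SOME\<close> in
    \<open>scale_space\<close> meaningful; the chosen value may come from another solution and
    horizon, and the mean is conserved for all of them.\<close>
  then obtain u where "weak_solution \<Omega> D (t + 1) u0 u"
    by (force simp: well_posed_def)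
  then have "\<exists>w T u. 0 < T \<and> t \<in> {0..T} \<and> weak_solution \<Omega> D T u0 u \<and> w = u t"
    using t by (intro exI[of _ "u t"] exI[of _ "t + 1"] exI[of _ u]) auto
  then obtain T u where "0 < T" "t \<in> {0..T}" "weak_solution \<Omega> D T u0 u" "scale_space \<Omega> D t u0 = u t"
    unfolding scale_space_def by (rule someI_ex[elim_format]) blast
  then show "mean_vector \<Omega> (scale_space \<Omega> D t u0) = mean_vector \<Omega> u0"
    using weak_solution_mean_vector assms(1,5) by metis
qed

end
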